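(* Let $\mathfrak{g}$ be a complex simple Lie algebra of rank $n$ of one of the types $A_1$, $B_n\,(n\ge 2)$, $C_n\,(n\ge 3)$, $D_{2k}\,(k\ge 2)$, $E_7$, $E_8$, $F_4$, $G_2$, and let $M^+=\frac12Q\cap P^+$ be the monoid associated with $\mathfrak{g}$. Then the monoid algebra $\mathbb{C}[M^+]$ is isomorphic to the polynomial algebra $\mathbb{C}[x_1,\dots,x_n]$ in $n$ variables.
   Context: $Q$ is the root lattice of $\mathfrak{g}$, $\frac12Q=\{\frac12\alpha\mid\alpha\in Q\}$, and $P^+$ is the set of dominant integral weights (non-negative integer combinations of the fundamental weights $\varpi_1,\dots,\varpi_n$). $M^+$ is an additive monoid. The monoid algebra $\mathbb{C}[M^+]$ has $\mathbb{C}$-basis $X^\lambda$, $\lambda\in M^+$, with multiplication $X^\lambda X^\mu=X^{\lambda+\mu}$ and $X^0=1$. *)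

theory Defs
  imports Complex_Main "HOL-Library.Function_Algebras" "HOL-Library.Poly_Mapping"
begin

section \<open>Simple complex Lie algebras, roots and weights\<close>

text \<open>
  Linear functionals on a subspace \<open>H\<close> of the Lie algebra are represented as functions on the whole
  Lie algebra that vanish outside \<open>H\<close>, so that equality of functionals is equality of functions.
  Sums, negatives and the zero functional are the pointwise operations of
  \<^theory>\<open>HOL-Library.Function_Algebras\<close>.
\<close>

definition fscale :: "complex \<Rightarrow> ('g \<Rightarrow> complex) \<Rightarrow> ('g \<Rightarrow> complex)"  (infixr \<open>*\<^sub>f\<close> 75)
  where "c *\<^sub>f f = (\<lambda>x. c * f x)"

interpretation functional: vector_space fscale
  by unfold_locales (auto simp: fscale_def fun_eq_iff algebra_simps)

locale complex_lie_algebra = vector_space scale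
  for scale :: "complex \<Rightarrow> 'g::ab_group_add \<Rightarrow> 'g"  (infixr \<open>*s\<close> 75) +
  fixes bracket :: "'g \<Rightarrow> 'g \<Rightarrow> 'g"  (\<open>[_,/ _]\<^sub>L\<close>)
  assumes bracket_add_left: "[x + y, z]\<^sub>L = [x, z]\<^sub>L + [y, z]\<^sub>L"
    and bracket_add_right: "[x, y + z]\<^sub>L = [x, y]\<^sub>L + [x, z]\<^sub>L"
    and bracket_scale_left: "[c *s x, y]\<^sub>L = c *s [x, y]\<^sub>L"
    and bracket_scale_right: "[x, c *s y]\<^sub>L = c *s [x, y]\<^sub>L"
    and bracket_self: "[x, x]\<^sub>L = 0"
    and jacobi: "[x, [y, z]\<^sub>L]\<^sub>L + [y, [z, x]\<^sub>L]\<^sub>L + [z, [x, y]\<^sub>L]\<^sub>L = 0"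
    and finite_dim: "\<exists>B. finite B \<and> span B = UNIV"
begin

definition lie_ideal :: "'g set \<Rightarrow> bool"
  where "lie_ideal I \<longleftrightarrow> subspace I \<and> (\<forall>x. \<forall>y\<in>I. [x, y]\<^sub>L \<in> I)"

definition lie_subalgebra :: "'g set \<Rightarrow> bool"
  where "lie_subalgebra H \<longleftrightarrow> subspace H \<and> (\<forall>x\<in>H. \<forall>y\<in>H. [x, y]\<^sub>L \<in> H)"

definition bracket_span :: "'g set \<Rightarrow> 'g set \<Rightarrow> 'g set"
  where "bracket_span A B = span {[x, y]\<^sub>L | x y. x \<in> A \<and> y \<in> B}"

primrec lower_central_series :: "'g set \<Rightarrow> nat \<Rightarrow> 'g set" where
  "lower_central_series H 0 = H"
| "lower_central_series H (Suc k) = bracket_span H (lower_central_series H k)"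

definition lie_nilpotent :: "'g set \<Rightarrow> bool"
  where "lie_nilpotent H \<longleftrightarrow> (\<exists>k. lower_central_series H k = {0})"

definition normalizer :: "'g set \<Rightarrow> 'g set"
  where "normalizer H = {x. \<forall>h\<in>H. [x, h]\<^sub>L \<in> H}"

definition cartan_subalgebra :: "'g set \<Rightarrow> bool"
  where "cartan_subalgebra H \<longleftrightarrow> lie_subalgebra H \<and> lie_nilpotent H \<and> normalizer H = H"

definition dual :: "'g set \<Rightarrow> ('g \<Rightarrow> complex) set"
  where "dual H = {f. (\<forall>x\<in>H. \<forall>y\<in>H. f (x + y) = f x + f y) \<and>
                      (\<forall>c. \<forall>x\<in>H. f (c *s x) = c * f x) \<and>
                      (\<forall>x. x \<notin> H \<longrightarrow> f x = 0)}"

definition root_space :: "'g set \<Rightarrow> ('g \<Rightarrow> complex) \<Rightarrow> 'g set"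
  where "root_space H \<alpha> = {x. \<forall>h\<in>H. [h, x]\<^sub>L = \<alpha> h *s x}"

definition roots :: "'g set \<Rightarrow> ('g \<Rightarrow> complex) set"
  where "roots H = {\<alpha> \<in> dual H. \<alpha> \<noteq> 0 \<and> root_space H \<alpha> \<noteq> {0}}"

text \<open>
  For a simple Lie algebra, \<open>[\<gg>\<^sub>\<alpha>, \<gg>\<^sub>-\<^sub>\<alpha>]\<close> is a line in \<open>H\<close> on which \<open>\<alpha>\<close> does not vanish, so the
  following description determines the coroot \<open>\<alpha>\<^sup>\<or>\<close>.
\<close>

definition coroot :: "'g set \<Rightarrow> ('g \<Rightarrow> complex) \<Rightarrow> 'g"
  where "coroot H \<alpha> =
    (THE h. h \<in> bracket_span (root_space H \<alpha>) (root_space H (- \<alpha>)) \<and> \<alpha> h = 2)"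

definition simple_roots :: "'g set \<Rightarrow> ('g \<Rightarrow> complex) set \<Rightarrow> bool"
  where "simple_roots H \<Pi> \<longleftrightarrow>
    \<Pi> \<subseteq> roots H \<and> functional.independent \<Pi> \<and> functional.span \<Pi> = dual H \<and>
    (\<forall>\<beta>\<in>roots H. \<exists>c :: ('g \<Rightarrow> complex) \<Rightarrow> nat.
       \<beta> = (\<Sum>\<alpha>\<in>\<Pi>. of_nat (c \<alpha>) *\<^sub>f \<alpha>) \<or> \<beta> = - (\<Sum>\<alpha>\<in>\<Pi>. of_nat (c \<alpha>) *\<^sub>f \<alpha>))"

definition root_lattice :: "'g set \<Rightarrow> ('g \<Rightarrow> complex) set"
  where "root_lattice H =
    {\<Sum>\<alpha>\<in>S. of_int (c \<alpha>) *\<^sub>f \<alpha> | S (c :: ('g \<Rightarrow> complex) \<Rightarrow> int). finite S \<and> S \<subseteq> roots H}"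

definition half_root_lattice :: "'g set \<Rightarrow> ('g \<Rightarrow> complex) set"
  where "half_root_lattice H = {(1 / 2) *\<^sub>f \<alpha> | \<alpha>. \<alpha> \<in> root_lattice H}"

definition fundamental_weight ::
    "'g set \<Rightarrow> ('g \<Rightarrow> complex) set \<Rightarrow> ('g \<Rightarrow> complex) \<Rightarrow> ('g \<Rightarrow> complex)"
  where "fundamental_weight H \<Pi> \<alpha> =
    (THE \<omega>. \<omega> \<in> dual H \<and> (\<forall>\<beta>\<in>\<Pi>. \<omega> (coroot H \<beta>) = (if \<beta> = \<alpha> then 1 else 0)))"

definition dominant_weights :: "'g set \<Rightarrow> ('g \<Rightarrow> complex) set \<Rightarrow> ('g \<Rightarrow> complex) set"
  where "dominant_weights H \<Pi> =
    {\<Sum>\<alpha>\<in>\<Pi>. of_nat (m \<alpha>) *\<^sub>f fundamental_weight H \<Pi> \<alpha> | m :: ('g \<Rightarrow> complex) \<Rightarrow> nat. True}"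

definition M_plus :: "'g set \<Rightarrow> ('g \<Rightarrow> complex) set \<Rightarrow> ('g \<Rightarrow> complex) set"
  where "M_plus H \<Pi> = half_root_lattice H \<inter> dominant_weights H \<Pi>"

end

locale simple_complex_lie_algebra = complex_lie_algebra +
  assumes nonabelian: "\<exists>x y. bracket x y \<noteq> 0"
    and no_proper_ideal: "lie_ideal I \<Longrightarrow> I = {0} \<or> I = UNIV"


section \<open>Cartan types\<close>

datatype cartan_type =
  Type_A nat | Type_B nat | Type_C nat | Type_D nat | Type_E6 | Type_E7 | Type_E8 | Type_F4 | Type_G2

primrec cartan_rank :: "cartan_type \<Rightarrow> nat" where
  "cartan_rank (Type_A n) = n"
| "cartan_rank (Type_B n) = n"
| "cartan_rank (Type_C n) = n"
| "cartan_rank (Type_D n) = n"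
| "cartan_rank Type_E6 = 6"
| "cartan_rank Type_E7 = 7"
| "cartan_rank Type_E8 = 8"
| "cartan_rank Type_F4 = 4"
| "cartan_rank Type_G2 = 2"

definition simply_laced :: "(nat \<times> nat) set \<Rightarrow> nat \<Rightarrow> nat \<Rightarrow> int"
  where "simply_laced E i j =
    (if i = j then 2 else if (i, j) \<in> E \<or> (j, i) \<in> E then -1 else 0)"

definition path_edges :: "nat \<Rightarrow> (nat \<times> nat) set"
  where "path_edges n = {(i, i + 1) | i. 1 \<le> i \<and> i < n}"

text \<open>
  Bourbaki's numbering \<open>1, \<dots>, n\<close> of the simple roots and Bourbaki's convention that the entry
  \<open>(i, j)\<close> is \<open>\<langle>\<alpha>\<^sub>i, \<alpha>\<^sub>j\<^sup>\<or>\<rangle>\<close>; thus an entry \<open>-2\<close> or \<open>-3\<close> occurs when \<open>\<alpha>\<^sub>i\<close> is the longer root.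
\<close>

fun cartan_matrix :: "cartan_type \<Rightarrow> nat \<Rightarrow> nat \<Rightarrow> int" where
  "cartan_matrix (Type_A n) i j = simply_laced (path_edges n) i j"
| "cartan_matrix (Type_B n) i j =
     (if i + 1 = n \<and> j = n then -2 else simply_laced (path_edges n) i j)"
| "cartan_matrix (Type_C n) i j =
     (if i = n \<and> j + 1 = n then -2 else simply_laced (path_edges n) i j)"
| "cartan_matrix (Type_D n) i j =
     simply_laced (path_edges (n - 1) \<union> {(n - 2, n)}) i j"
| "cartan_matrix Type_E6 i j = simply_laced {(1,3), (3,4), (4,5), (5,6), (2,4)} i j"
| "cartan_matrix Type_E7 i j = simply_laced {(1,3), (3,4), (4,5), (5,6), (6,7), (2,4)} i j"
| "cartan_matrix Type_E8 i j = simply_laced {(1,3), (3,4), (4,5), (5,6), (6,7), (7,8), (2,4)} i j"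
| "cartan_matrix Type_F4 i j =
     (if i = 2 \<and> j = 3 then -2 else simply_laced (path_edges 4) i j)"
| "cartan_matrix Type_G2 i j =
     (if i = 2 \<and> j = 1 then -3 else simply_laced (path_edges 2) i j)"

context complex_lie_algebra
begin

definition has_type :: "'g set \<Rightarrow> ('g \<Rightarrow> complex) set \<Rightarrow> cartan_type \<Rightarrow> bool"
  where "has_type H \<Pi> X \<longleftrightarrow>
    (\<exists>\<alpha>. bij_betw \<alpha> {1..cartan_rank X} \<Pi> \<and>
       (\<forall>i\<in>{1..cartan_rank X}. \<forall>j\<in>{1..cartan_rank X}.
          \<alpha> i (coroot H (\<alpha> j)) = of_int (cartan_matrix X i j)))"

end


section \<open>Monoid algebras and polynomial algebras\<close>

text \<open>
  On \<open>'a \<Rightarrow>\<^sub>0 complex\<close> multiplication is convolution, so \<open>X\<^sup>\<lambda>\<close> is \<open>Poly_Mapping.single \<lambda> 1\<close>. For a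
  submonoid \<open>M\<close> of \<open>'a\<close>, the algebra \<open>\<complex>[M]\<close> is the subalgebra of the elements supported on \<open>M\<close>.
\<close>

definition monoid_algebra :: "'a::comm_monoid_add set \<Rightarrow> ('a \<Rightarrow>\<^sub>0 complex) set"
  where "monoid_algebra M = {p. Poly_Mapping.keys p \<subseteq> M}"

text \<open>Monomials in the variables \<open>x\<^sub>i\<close> are given by their exponents \<open>nat \<Rightarrow>\<^sub>0 nat\<close>.\<close>

definition polynomial_algebra :: "nat \<Rightarrow> ((nat \<Rightarrow>\<^sub>0 nat) \<Rightarrow>\<^sub>0 complex) set"
  where "polynomial_algebra n =
    {p. \<forall>m\<in>Poly_Mapping.keys p. Poly_Mapping.keys m \<subseteq> {1..n}}"

definition algebra_isomorphic ::
    "('a::comm_monoid_add \<Rightarrow>\<^sub>0 complex) set \<Rightarrow> ('b::comm_monoid_add \<Rightarrow>\<^sub>0 complex) set \<Rightarrow> bool"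
  where "algebra_isomorphic A B \<longleftrightarrow>
    (\<exists>\<phi>. bij_betw \<phi> A B \<and> \<phi> 1 = 1 \<and>
       (\<forall>p\<in>A. \<forall>q\<in>A. \<phi> (p + q) = \<phi> p + \<phi> q \<and> \<phi> (p * q) = \<phi> p * \<phi> q) \<and>
       (\<forall>c. \<forall>p\<in>A. \<phi> (Poly_Mapping.map ((*) c) p) = Poly_Mapping.map ((*) c) (\<phi> p)))"

lemma monoid_algebra_closed:
  assumes "0 \<in> M" and "\<And>x y. x \<in> M \<Longrightarrow> y \<in> M \<Longrightarrow> x + y \<in> M"
  shows "1 \<in> monoid_algebra M"
    and "p \<in> monoid_algebra M \<Longrightarrow> q \<in> monoid_algebra M \<Longrightarrow> p + q \<in> monoid_algebra M"
    and "p \<in> monoid_algebra M \<Longrightarrow> q \<in> monoid_algebra M \<Longrightarrow> p * q \<in> monoid_algebra M"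
    and "p \<in> monoid_algebra M \<Longrightarrow> Poly_Mapping.map ((*) c) p \<in> monoid_algebra M"
proof -
  show "1 \<in> monoid_algebra M"
    using assms(1) by (simp add: monoid_algebra_def flip: single_one)
  show "p + q \<in> monoid_algebra M" if "p \<in> monoid_algebra M" "q \<in> monoid_algebra M"
    using that Poly_Mapping.keys_add[of p q] by (auto simp: monoid_algebra_def)
  show "p * q \<in> monoid_algebra M" if "p \<in> monoid_algebra M" "q \<in> monoid_algebra M"
    using that keys_mult[of p q] assms(2) by (fastforce simp: monoid_algebra_def)
  show "Poly_Mapping.map ((*) c) p \<in> monoid_algebra M" if "p \<in> monoid_algebra M"
    using that by (auto simp: monoid_algebra_def in_keys_iff map.rep_eq when_def split: if_splits)
qed

context complex_lie_algebra
begin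

lemma root_lattice_add:
  assumes "a \<in> root_lattice H" and "b \<in> root_lattice H"
  shows "a + b \<in> root_lattice H"
proof -
  obtain S c where S: "finite S" "S \<subseteq> roots H"
    and a: "a = (\<Sum>\<alpha>\<in>S. of_int (c \<alpha>) *\<^sub>f \<alpha>)"
    using assms(1) by (auto simp: root_lattice_def)
  obtain T d where T: "finite T" "T \<subseteq> roots H"
    and b: "b = (\<Sum>\<alpha>\<in>T. of_int (d \<alpha>) *\<^sub>f \<alpha>)"
    using assms(2) by (auto simp: root_lattice_def)
  define c' where "c' \<alpha> = (if \<alpha> \<in> S then c \<alpha> else 0)" for \<alpha>
  define d' where "d' \<alpha> = (if \<alpha> \<in> T then d \<alpha> else 0)" for \<alpha>
  have "a = (\<Sum>\<alpha>\<in>S \<union> T. of_int (c' \<alpha>) *\<^sub>f \<alpha>)"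
    unfolding a by (rule sum.mono_neutral_cong_left) (use S T in \<open>auto simp: c'_def\<close>)
  moreover have "b = (\<Sum>\<alpha>\<in>S \<union> T. of_int (d' \<alpha>) *\<^sub>f \<alpha>)"
    unfolding b by (rule sum.mono_neutral_cong_left) (use S T in \<open>auto simp: d'_def\<close>)
  ultimately have "a + b = (\<Sum>\<alpha>\<in>S \<union> T. of_int (c' \<alpha> + d' \<alpha>) *\<^sub>f \<alpha>)"
    by (simp only: of_int_add functional.scale_left_distrib sum.distrib)
  then show ?thesis
    unfolding root_lattice_def using S T
    by (intro CollectI exI[of _ "S \<union> T"] exI[of _ "\<lambda>\<alpha>. c' \<alpha> + d' \<alpha>"]) auto
qed

lemma M_plus_zero: "0 \<in> M_plus H \<Pi>"
proof -
  have "0 \<in> root_lattice H"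
    unfolding root_lattice_def by (intro CollectI exI[of _ "{}"]) auto
  then have "0 \<in> half_root_lattice H"
    unfolding half_root_lattice_def by (intro CollectI exI[of _ 0]) auto
  moreover have "0 \<in> dominant_weights H \<Pi>"
    unfolding dominant_weights_def by (intro CollectI exI[of _ "\<lambda>_. 0"]) simp
  ultimately show ?thesis
    by (simp add: M_plus_def)
qed

lemma M_plus_add:
  assumes "a \<in> M_plus H \<Pi>" and "b \<in> M_plus H \<Pi>"
  shows "a + b \<in> M_plus H \<Pi>"
proof -
  obtain a' b' where ab: "a' \<in> root_lattice H" "b' \<in> root_lattice H"
      "a = (1 / 2) *\<^sub>f a'" "b = (1 / 2) *\<^sub>f b'"
    using assms by (auto simp: M_plus_def half_root_lattice_def)
  then have "a + b = (1 / 2) *\<^sub>f (a' + b')"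
    by (simp only: functional.scale_right_distrib)
  then have "a + b \<in> half_root_lattice H"
    unfolding half_root_lattice_def using root_lattice_add[OF ab(1,2)] by blast
  moreover obtain k l :: "('g \<Rightarrow> complex) \<Rightarrow> nat"
    where "a = (\<Sum>\<alpha>\<in>\<Pi>. of_nat (k \<alpha>) *\<^sub>f fundamental_weight H \<Pi> \<alpha>)"
      "b = (\<Sum>\<alpha>\<in>\<Pi>. of_nat (l \<alpha>) *\<^sub>f fundamental_weight H \<Pi> \<alpha>)"
    using assms by (auto simp: M_plus_def dominant_weights_def)
  then have "a + b = (\<Sum>\<alpha>\<in>\<Pi>. of_nat (k \<alpha> + l \<alpha>) *\<^sub>f fundamental_weight H \<Pi> \<alpha>)"
    by (simp only: of_nat_add functional.scale_left_distrib sum.distrib)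
  then have "a + b \<in> dominant_weights H \<Pi>"
    unfolding dominant_weights_def by (intro CollectI exI[of _ "\<lambda>\<alpha>. k \<alpha> + l \<alpha>"]) simp
  ultimately show ?thesis
    by (simp add: M_plus_def)
qed

end

end

(*
  Since -1 lies in the Weyl group, 2P is contained in Q; concretely, twice the inverse of the
  Cartan matrix is integral. Hence every fundamental weight lies in Q/2, so M+ = P+ is the free
  commutative monoid on the n fundamental weights, and its monoid algebra is the polynomial
  algebra. The coroots only enter through the pairings recorded by the Cartan matrix: as that
  matrix is invertible, these already determine the fundamental weights.
*)
theory Submission
  imports Defs
begin

section \<open>Isomorphisms of monoid algebras\<close>

text \<open>The linear map that sends X^k to X^(h k). Coefficients of keys identified by
  \<open>h\<close> are added, so \<open>h\<close> may be any function.\<close>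

definition push_keys :: "('a \<Rightarrow> 'b) \<Rightarrow> ('a \<Rightarrow>\<^sub>0 'c::comm_monoid_add) \<Rightarrow> ('b \<Rightarrow>\<^sub>0 'c)"
  where "push_keys h p = (\<Sum>k\<in>Poly_Mapping.keys p. Poly_Mapping.single (h k) (Poly_Mapping.lookup p k))"

text \<open>Indices outside the support contribute \<open>single (h k) 0\<close>, which is zero. A
  common index set makes elements with different supports comparable.\<close>

lemma push_keys_superset:
  assumes "finite S" "Poly_Mapping.keys p \<subseteq> S"
  shows "push_keys h p = (\<Sum>k\<in>S. Poly_Mapping.single (h k) (Poly_Mapping.lookup p k))"
  unfolding push_keys_def
  by (rule sum.mono_neutral_left) (use assms in \<open>auto simp: in_keys_iff\<close>)

lemma push_keys_add: "push_keys h (p + q) = push_keys h p + push_keys h q"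
proof -
  let ?S = "Poly_Mapping.keys p \<union> Poly_Mapping.keys q"
  have eq: "push_keys h r = (\<Sum>k\<in>?S. Poly_Mapping.single (h k) (Poly_Mapping.lookup r k))"
    if "Poly_Mapping.keys r \<subseteq> ?S" for r
    by (rule push_keys_superset) (use that in auto)
  then show ?thesis
    using Poly_Mapping.keys_add[of p q] eq[of "p + q"] eq[of p] eq[of q]
    by (simp add: lookup_add single_add sum.distrib)
qed

lemma push_keys_single [simp]: "push_keys h (Poly_Mapping.single k c) = Poly_Mapping.single (h k) c"
  by (simp add: push_keys_def)

lemma push_keys_zero [simp]: "push_keys h 0 = 0"
  by (simp add: push_keys_def)

lemma push_keys_sum: "push_keys h (\<Sum>i\<in>I. f i) = (\<Sum>i\<in>I. push_keys h (f i))"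
  by (induction I rule: infinite_finite_induct) (auto simp: push_keys_add)

lemma poly_mapping_eq_sum_single: "p = (\<Sum>k\<in>Poly_Mapping.keys p. Poly_Mapping.single k (Poly_Mapping.lookup p k))"
  by (rule poly_mapping_eqI)
     (auto simp: lookup_sum lookup_single when_def in_keys_iff)

text \<open>Bilinearity reduces the identity to products of monomials. Additivity is asked for on
  the supports alone, because \<open>h\<close> will be additive only on a submonoid.\<close>

lemma push_keys_mult:
  fixes p q :: "'a::comm_monoid_add \<Rightarrow>\<^sub>0 'c::comm_semiring_1"
    and h :: "'a \<Rightarrow> 'b::comm_monoid_add"
  assumes "\<And>x y. x \<in> Poly_Mapping.keys p \<Longrightarrow> y \<in> Poly_Mapping.keys q \<Longrightarrow> h (x + y) = h x + h y"
  shows "push_keys h (p * q) = push_keys h p * push_keys h q"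
proof -
  have "p * q = (\<Sum>x\<in>Poly_Mapping.keys p. \<Sum>y\<in>Poly_Mapping.keys q. Poly_Mapping.single (x + y) (Poly_Mapping.lookup p x * Poly_Mapping.lookup q y))"
    using arg_cong2[OF poly_mapping_eq_sum_single[of p] poly_mapping_eq_sum_single[of q], of "(*)"]
    by (simp add: sum_product mult_single)
  also have "push_keys h \<dots> =
      (\<Sum>x\<in>Poly_Mapping.keys p. \<Sum>y\<in>Poly_Mapping.keys q. Poly_Mapping.single (h x + h y) (Poly_Mapping.lookup p x * Poly_Mapping.lookup q y))"
    using assms by (simp add: push_keys_sum)
  also have "\<dots> = push_keys h p * push_keys h q"
    by (simp add: push_keys_def sum_product mult_single)
  finally show ?thesis .
qed

lemma push_keys_scale:
  fixes c :: "'c::semiring_0"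
  shows "push_keys h (Poly_Mapping.map ((*) c) p) = Poly_Mapping.map ((*) c) (push_keys h p)"
proof -
  have lookup_scale: "Poly_Mapping.lookup (Poly_Mapping.map ((*) c) q) x = c * Poly_Mapping.lookup q x" for q :: "'x \<Rightarrow>\<^sub>0 'c" and x
    by (simp add: map.rep_eq when_def)
  have "push_keys h (Poly_Mapping.map ((*) c) p)
      = (\<Sum>k\<in>Poly_Mapping.keys p. Poly_Mapping.single (h k) (c * Poly_Mapping.lookup p k))"
    \<comment> \<open>Scaling may shrink the support, as for \<open>c = 0\<close>, so the sum is
      kept over the support of \<open>p\<close>.\<close>
    by (subst push_keys_superset[of "Poly_Mapping.keys p"]) (auto simp: lookup_scale in_keys_iff)
  also have "\<dots> = Poly_Mapping.map ((*) c) (push_keys h p)"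
    by (rule poly_mapping_eqI)
       (simp add: lookup_scale push_keys_def lookup_sum sum_distrib_left lookup_single when_def
          if_distrib cong: if_cong)
  finally show ?thesis .
qed

text \<open>In general only an inclusion: coefficients collected at one key may cancel.\<close>

lemma keys_push_keys: "Poly_Mapping.keys (push_keys h p) \<subseteq> h ` Poly_Mapping.keys p"
proof
  fix x assume "x \<in> Poly_Mapping.keys (push_keys h p)"
  then have "(\<Sum>k\<in>Poly_Mapping.keys p. Poly_Mapping.lookup (Poly_Mapping.single (h k) (Poly_Mapping.lookup p k)) x) \<noteq> 0"
    by (simp add: push_keys_def lookup_sum in_keys_iff)
  then obtain k where "k \<in> Poly_Mapping.keys p" "Poly_Mapping.lookup (Poly_Mapping.single (h k) (Poly_Mapping.lookup p k)) x \<noteq> 0"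
    by (meson sum.not_neutral_contains_not_neutral)
  then show "x \<in> h ` Poly_Mapping.keys p"
    by (auto simp: lookup_single when_def split: if_splits)
qed

lemma push_keys_cong:
  assumes "\<And>k. k \<in> Poly_Mapping.keys p \<Longrightarrow> h k = g k"
  shows "push_keys h p = push_keys g p"
  unfolding push_keys_def using assms by simp

lemma push_keys_push_keys: "push_keys g (push_keys h p) = push_keys (g \<circ> h) p"
  unfolding push_keys_def[of h] by (simp add: push_keys_sum push_keys_def[of "g \<circ> h"])

lemma push_keys_inverse:
  assumes "\<And>k. k \<in> Poly_Mapping.keys p \<Longrightarrow> g (h k) = k"
  shows "push_keys g (push_keys h p) = p"
proof -
  have "push_keys g (push_keys h p) = push_keys id p"
    unfolding push_keys_push_keys by (rule push_keys_cong) (use assms in auto)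
  also have "\<dots> = p"
    using poly_mapping_eq_sum_single[of p] by (simp add: push_keys_def)
  finally show ?thesis .
qed

text \<open>Monoid algebras are functorial: a monoid isomorphism extends linearly to an algebra
  isomorphism, whose inverse is the extension of the inverse map.\<close>

lemma algebra_isomorphic_monoid_algebra:
  fixes h :: "'a::comm_monoid_add \<Rightarrow> 'b::comm_monoid_add"
  assumes "bij_betw h M N" "h 0 = 0" "\<And>x y. x \<in> M \<Longrightarrow> y \<in> M \<Longrightarrow> h (x + y) = h x + h y"
  shows "algebra_isomorphic (monoid_algebra M) (monoid_algebra N)"
proof -
  let ?g = "inv_into M h"
  have g: "bij_betw ?g N M"
    using assms(1) by (rule bij_betw_inv_into)
  have "bij_betw (push_keys h :: _ \<Rightarrow> _ \<Rightarrow>\<^sub>0 complex) (monoid_algebra M) (monoid_algebra N)"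
  proof (rule bij_betw_byWitness[where f' = "push_keys ?g"])
    show "\<forall>p\<in>monoid_algebra M. push_keys ?g (push_keys h p) = p"
      using assms(1) by (auto simp: monoid_algebra_def bij_betw_inv_into_left intro!: push_keys_inverse)
    show "\<forall>p\<in>monoid_algebra N. push_keys h (push_keys ?g p) = p"
      using assms(1) by (auto simp: monoid_algebra_def bij_betw_inv_into_right intro!: push_keys_inverse)
    show "push_keys h ` monoid_algebra M \<subseteq> monoid_algebra N"
      using keys_push_keys[of h] bij_betw_imp_surj_on[OF assms(1)]
      unfolding monoid_algebra_def by blast
    show "push_keys ?g ` monoid_algebra N \<subseteq> monoid_algebra M"
      using keys_push_keys[of ?g] bij_betw_imp_surj_on[OF g]
      unfolding monoid_algebra_def by blast
  qed
  moreover have "push_keys h 1 = (1 :: _ \<Rightarrow>\<^sub>0 complex)"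
    using assms(2) by (simp flip: single_one)
  moreover have "push_keys h (p * q) = push_keys h p * push_keys h q"
    if "p \<in> monoid_algebra M" "q \<in> monoid_algebra M" for p q :: "_ \<Rightarrow>\<^sub>0 complex"
    by (rule push_keys_mult) (use that assms(3) in \<open>auto simp: monoid_algebra_def\<close>)
  ultimately show ?thesis
    unfolding algebra_isomorphic_def
    by (intro exI[of _ "push_keys h"]) (simp add: push_keys_add push_keys_scale)
qed

text \<open>Monomials are exponent vectors, so polynomials form the monoid algebra of a free
  commutative monoid.\<close>

lemma polynomial_algebra_eq_monoid_algebra:
  "polynomial_algebra n = monoid_algebra {m :: nat \<Rightarrow>\<^sub>0 nat. Poly_Mapping.keys m \<subseteq> {1..n}}"
  by (auto simp: polynomial_algebra_def monoid_algebra_def)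


section \<open>Twice the inverse Cartan matrix\<close>

lemma simply_laced_path:
  assumes "1 \<le> i" "i \<le> n" "1 \<le> j" "j \<le> n"
  shows "simply_laced (path_edges n) i j =
    (if i = j then 2 else 0) - (if i = j - 1 then 1 else 0) - (if i = j + 1 then 1 else 0)"
  using assms by (auto simp: simply_laced_def path_edges_def)

text \<open>Pairing with a column of a path matrix is a negated second difference. The convention
  \<open>f 0 = 0\<close> makes \<open>j = 1\<close> fit the general formula; the other end needs the
  case distinction.\<close>

lemma sum_simply_laced_path:
  fixes f :: "nat \<Rightarrow> int"
  assumes "1 \<le> j" "j \<le> n" "f 0 = 0"
  shows "(\<Sum>i=1..n. f i * simply_laced (path_edges n) i j) =
    2 * f j - f (j - 1) - (if j < n then f (j + 1) else 0)"
proof -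
  have "(\<Sum>i=1..n. f i * simply_laced (path_edges n) i j) =
      (\<Sum>i=1..n. (if i = j then 2 * f i else 0) - (if i = j - 1 then f i else 0)
        - (if i = j + 1 then f i else 0))"
    by (rule sum.cong) (use assms in \<open>auto simp: simply_laced_path\<close>)
  also have "\<dots> = 2 * f j - f (j - 1) - (if j < n then f (j + 1) else 0)"
    using assms by (auto simp: sum_subtractf not_le)
  finally show ?thesis .
qed

text \<open>The matrix differs from that of a path only at \<open>(n - 1, n)\<close>, where -2
  replaces -1; column \<open>n\<close> thus receives an extra \<open>- f (n - 1)\<close>.\<close>

lemma sum_cartan_matrix_B:
  fixes f :: "nat \<Rightarrow> int"
  assumes "2 \<le> n" "1 \<le> j" "j \<le> n" "f 0 = 0"
  shows "(\<Sum>i=1..n. f i * cartan_matrix (Type_B n) i j) =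
    (if j = n then 2 * f n - 2 * f (n - 1) else 2 * f j - f (j - 1) - f (j + 1))"
proof -
  have "(\<Sum>i=1..n. f i * cartan_matrix (Type_B n) i j) =
      (\<Sum>i=1..n. f i * simply_laced (path_edges n) i j
        - (if i = n - 1 then if j = n then f i else 0 else 0))"
    by (rule sum.cong) (use assms in \<open>auto simp: simply_laced_path\<close>)
  also have "\<dots> = (\<Sum>i=1..n. f i * simply_laced (path_edges n) i j) - (if j = n then f (n - 1) else 0)"
    using assms by (auto simp: sum_subtractf)
  finally show ?thesis
    unfolding sum_simply_laced_path[where f = f, OF assms(2-4)] using assms by auto
qed

text \<open>Here the entry -2 sits at \<open>(n, n - 1)\<close>, so the correction
  \<open>- f n\<close> falls in column \<open>n - 1\<close>.\<close>

lemma sum_cartan_matrix_C: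
  fixes f :: "nat \<Rightarrow> int"
  assumes "2 \<le> n" "1 \<le> j" "j \<le> n" "f 0 = 0"
  shows "(\<Sum>i=1..n. f i * cartan_matrix (Type_C n) i j) =
    (if j = n then 2 * f n - f (n - 1)
     else if j = n - 1 then 2 * f j - f (j - 1) - 2 * f n
     else 2 * f j - f (j - 1) - f (j + 1))"
proof -
  have "(\<Sum>i=1..n. f i * cartan_matrix (Type_C n) i j) =
      (\<Sum>i=1..n. f i * simply_laced (path_edges n) i j
        - (if i = n then if j = n - 1 then f i else 0 else 0))"
    by (rule sum.cong) (use assms in \<open>auto simp: simply_laced_path\<close>)
  also have "\<dots> = (\<Sum>i=1..n. f i * simply_laced (path_edges n) i j) - (if j = n - 1 then f n else 0)"
    using assms by (auto simp: sum_subtractf)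
  finally show ?thesis
    unfolding sum_simply_laced_path[where f = f, OF assms(2-4)] using assms by auto
qed

text \<open>Deleting node \<open>n\<close> leaves a path with \<open>r = n - 1\<close> nodes; the
  deleted node is joined to \<open>n - 2\<close> only.\<close>

lemma sum_cartan_matrix_D:
  fixes f :: "nat \<Rightarrow> int"
  assumes "3 \<le> n" "1 \<le> j" "j \<le> n" "f 0 = 0"
  shows "(\<Sum>i=1..n. f i * cartan_matrix (Type_D n) i j) =
    (if j = n then 2 * f n - f (n - 2)
     else if j = n - 1 then 2 * f (n - 1) - f (n - 2)
     else if j = n - 2 then 2 * f j - f (j - 1) - f (n - 1) - f n
     else 2 * f j - f (j - 1) - f (j + 1))"
proof -
  obtain r where r: "n = Suc r" "2 \<le> r"
    using assms(1) by (cases n) auto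
  have split: "(\<Sum>i=1..n. f i * cartan_matrix (Type_D n) i j) =
      (\<Sum>i=1..r. f i * cartan_matrix (Type_D n) i j) + f n * cartan_matrix (Type_D n) n j"
    using r by simp
  have last: "cartan_matrix (Type_D n) n j = (if j = n then 2 else if j = n - 2 then -1 else 0)"
    using assms r by (auto simp: simply_laced_def path_edges_def)
  show ?thesis
  proof (cases "j = n")
    case True
    have "(\<Sum>i=1..r. f i * cartan_matrix (Type_D n) i j) =
        (\<Sum>i=1..r. if i = n - 2 then - f i else 0)"
      by (rule sum.cong) (use True r in \<open>auto simp: simply_laced_def path_edges_def\<close>)
    then show ?thesis
      using True r unfolding split last by auto
  next
    case False
    have "(\<Sum>i=1..r. f i * cartan_matrix (Type_D n) i j) =
        (\<Sum>i=1..r. f i * simply_laced (path_edges r) i j)"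
      by (rule sum.cong) (use False assms r in \<open>auto simp: simply_laced_def\<close>)
    also have "\<dots> = 2 * f j - f (j - 1) - (if j < r then f (j + 1) else 0)"
      by (rule sum_simply_laced_path) (use False assms r in auto)
    finally show ?thesis
      using False assms(2,3) r unfolding split last by (auto simp: not_less le_Suc_eq)
  qed
qed

text \<open>On the index range \<open>D\<close> is twice the inverse Cartan matrix, with integrality
  expressed by the type \<open>int\<close>. Row \<open>j\<close> will be the simple-root coordinates
  of twice the fundamental weight \<open>j\<close>.\<close>

definition half_integral_inverse :: "cartan_type \<Rightarrow> (nat \<Rightarrow> nat \<Rightarrow> int) \<Rightarrow> bool"
  where "half_integral_inverse X D \<longleftrightarrow>
    (\<forall>j\<in>{1..cartan_rank X}. \<forall>k\<in>{1..cartan_rank X}.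
      (\<Sum>i=1..cartan_rank X. D j i * cartan_matrix X i k) = (if j = k then 2 else 0))"

section \<open>Explicit matrices, type by type\<close>

lemma half_integral_inverse_A1: "half_integral_inverse (Type_A 1) (\<lambda>j i. 1)"
  by (simp add: half_integral_inverse_def simply_laced_def)

text \<open>As a function of \<open>i\<close>, a row \<open>j < n\<close> has slope 2 up to
  \<open>j\<close> and is constant afterwards, so its negated second difference is 2 at
  \<open>j\<close> and 0 elsewhere. The last row belongs to the spin weight, with coordinates
  i/2.\<close>

lemma half_integral_inverse_B:
  assumes "2 \<le> n"
  shows "half_integral_inverse (Type_B n) (\<lambda>j i. if j = n then int i else 2 * int (min i j))"
  unfolding half_integral_inverse_def cartan_rank.simps
proof (intro ballI)
  fix j k assume "j \<in> {1..n}" "k \<in> {1..n}"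
  with assms show "(\<Sum>i=1..n. (if j = n then int i else 2 * int (min i j)) * cartan_matrix (Type_B n) i k)
      = (if j = k then 2 else 0)"
    by (subst sum_cartan_matrix_B) (auto simp: min_def)
qed

text \<open>The entry at the long root \<open>i = n\<close> is half of \<open>2 * min i j\<close>,
  which balances the -2 in row \<open>n\<close> of the Cartan matrix.\<close>

lemma half_integral_inverse_C:
  assumes "2 \<le> n"
  shows "half_integral_inverse (Type_C n) (\<lambda>j i. if i = n then int j else 2 * int (min i j))"
  unfolding half_integral_inverse_def cartan_rank.simps
proof (intro ballI)
  obtain r where n: "n = r + 2"
    using assms by (metis le_add_diff_inverse2)
  fix j k assume "j \<in> {1..n}" "k \<in> {1..n}"
  with n show "(\<Sum>i=1..n. (if i = n then int j else 2 * int (min i j)) * cartan_matrix (Type_C n) i k)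
      = (if j = k then 2 else 0)"
    by (subst sum_cartan_matrix_C) (auto simp: min_def split: if_splits)
qed

text \<open>The last two rows belong to the half-spin weights. Doubled, their coordinates at the
  nodes \<open>n - 1\<close> and \<open>n\<close> are n/2 and n/2 - 1 in some order; these are
  integers because \<open>n\<close> is even.\<close>

lemma half_integral_inverse_D:
  assumes "2 \<le> k"
  defines "n \<equiv> 2 * k"
  shows "half_integral_inverse (Type_D n) (\<lambda>j i.
    if j \<le> n - 2 then if i \<le> n - 2 then 2 * int (min i j) else int j
    else if i \<le> n - 2 then int i
    else if i = j then int k else int k - 1)" (is "half_integral_inverse _ ?D")
  unfolding half_integral_inverse_def cartan_rank.simps
proof (intro ballI)
  obtain q where k: "k = q + 2"
    using assms(1) by (metis le_add_diff_inverse2)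
  fix j l assume "j \<in> {1..n}" "l \<in> {1..n}"
  \<comment> \<open>The boundary condition \<open>f 0 = 0\<close> of the column formula, for row
    \<open>j\<close> extended to index 0.\<close>
  moreover have "3 \<le> n" "?D j 0 = 0"
    using assms by auto
  ultimately show "(\<Sum>i=1..n. ?D j i * cartan_matrix (Type_D n) i l) = (if j = l then 2 else 0)"
    by (subst sum_cartan_matrix_D) (auto simp: min_def n_def k split: if_splits)
qed

text \<open>The tables are checked by evaluation; indices are shifted because lists start at 0. For
  E8, F4 and G2 all entries are even, as the inverse itself is integral; for E7 only its double
  is.\<close>

lemma half_integral_inverse_exceptional:
  "half_integral_inverse Type_E7 (\<lambda>j i.
     [[4,4,6,8,6,4,2], [4,7,8,12,9,6,3], [6,8,12,16,12,8,4], [8,12,16,24,18,12,6],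
      [6,9,12,18,15,10,5], [4,6,8,12,10,8,4], [2,3,4,6,5,4,3]] ! (j - 1) ! (i - 1))" (is ?E7)
  "half_integral_inverse Type_E8 (\<lambda>j i.
     [[8,10,14,20,16,12,8,4], [10,16,20,30,24,18,12,6], [14,20,28,40,32,24,16,8],
      [20,30,40,60,48,36,24,12], [16,24,32,48,40,30,20,10], [12,18,24,36,30,24,16,8],
      [8,12,16,24,20,16,12,6], [4,6,8,12,10,8,6,4]] ! (j - 1) ! (i - 1))" (is ?E8)
  "half_integral_inverse Type_F4 (\<lambda>j i.
     [[4,6,8,4], [6,12,16,8], [4,8,12,6], [2,4,6,4]] ! (j - 1) ! (i - 1))" (is ?F4)
  "half_integral_inverse Type_G2 (\<lambda>j i. [[4,2], [6,4]] ! (j - 1) ! (i - 1))" (is ?G2)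
proof -
  have upto: "{1..2} = {1, 2::nat}" "{1..4} = {1, 2, 3, 4::nat}" "{1..7} = {1, 2, 3, 4, 5, 6, 7::nat}"
    "{1..8} = {1, 2, 3, 4, 5, 6, 7, 8::nat}"
    by auto
  show ?E7 ?E8 ?F4 ?G2
    unfolding half_integral_inverse_def cartan_rank.simps upto ball_simps
    by (simp_all add: simply_laced_def path_edges_def)
qed

text \<open>The list of types enters only here: the later arguments work with any Cartan matrix that
  admits such a \<open>D\<close>.\<close>

lemma half_integral_inverse_exists:
  assumes "X \<in> {Type_A 1} \<union> {Type_B m | m. m \<ge> 2} \<union> {Type_C m | m. m \<ge> 3}
           \<union> {Type_D (2 * k) | k. k \<ge> 2} \<union> {Type_E7, Type_E8, Type_F4, Type_G2}"
  shows "\<exists>D. half_integral_inverse X D"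
proof -
  consider "X = Type_A 1" | m where "X = Type_B m" "2 \<le> m" | m where "X = Type_C m" "2 \<le> m"
    | k where "X = Type_D (2 * k)" "2 \<le> k"
    | "X \<in> {Type_E7, Type_E8, Type_F4, Type_G2}"
    using assms by fastforce
  then show ?thesis
  proof cases
    case 1
    then show ?thesis using half_integral_inverse_A1 by blast
  next
    case 2
    then show ?thesis using half_integral_inverse_B by blast
  next
    case 3
    then show ?thesis using half_integral_inverse_C by blast
  next
    case 4
    then show ?thesis using half_integral_inverse_D by blast
  next
    case 5
    then show ?thesis using half_integral_inverse_exceptional by blast
  qed
qed


section \<open>Dual families of functionals\<close>

lemma sum_fscale_apply: "(\<Sum>i\<in>I. c i *\<^sub>f w i) x = (\<Sum>i\<in>I. c i * w i x)"
  by (induction I rule: infinite_finite_induct) (auto simp: fscale_def)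

text \<open>Evaluation at \<open>h j\<close> kills every term except that of index
  \<open>j\<close>.\<close>

lemma dual_family_coefficient:
  assumes "finite I" "j \<in> I" "\<And>i. i \<in> I \<Longrightarrow> w i (h j) = (if i = j then 1 else 0)"
  shows "(\<Sum>i\<in>I. c i *\<^sub>f w i) (h j) = c j"
proof -
  have "(\<Sum>i\<in>I. c i *\<^sub>f w i) (h j) = (\<Sum>i\<in>I. if i = j then c i else 0)"
    unfolding sum_fscale_apply by (rule sum.cong) (use assms(3) in auto)
  then show ?thesis
    using assms(1,2) by simp
qed

lemma dual_family_inj:
  assumes "\<And>i j. i \<in> I \<Longrightarrow> j \<in> I \<Longrightarrow> w i (h j) = (if i = j then 1 else (0::complex))"
  shows "inj_on w I"
proof (rule inj_onI)
  fix i j assume "i \<in> I" "j \<in> I" "w i = w j"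
  then show "i = j"
    using assms[of i i] assms[of j i] by (metis zero_neq_one)
qed

lemma dual_family_independent:
  assumes "finite I" "\<And>i j. i \<in> I \<Longrightarrow> j \<in> I \<Longrightarrow> w i (h j) = (if i = j then 1 else 0)"
  shows "functional.independent (w ` I)"
proof (rule functional.independent_if_scalars_zero)
  show "finite (w ` I)"
    using assms(1) by simp
  fix c v assume zero: "(\<Sum>x\<in>w ` I. c x *\<^sub>f x) = 0" and "v \<in> w ` I"
  then obtain j where j: "j \<in> I" "v = w j"
    by blast
  have "(\<Sum>i\<in>I. c (w i) *\<^sub>f w i) = 0"
    using zero by (simp add: sum.reindex[OF dual_family_inj[of I w h, OF assms(2)]])
  then show "c v = 0"
    using dual_family_coefficient[of I j w h "\<lambda>i. c (w i)"] assms j by simp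
qed

text \<open>The family is independent. If it did not span \<open>f\<close>, adjoining
  \<open>f\<close> would give \<open>card I + 1\<close> independent elements in the span of
  \<open>P\<close>, against the exchange bound. Evaluation at the \<open>h i\<close> then yields the
  coefficients.\<close>

lemma dual_family_expansion:
  assumes I: "finite I" "\<And>i j. i \<in> I \<Longrightarrow> j \<in> I \<Longrightarrow> w i (h j) = (if i = j then 1 else 0)"
    and w: "w ` I \<subseteq> functional.span P"
    and P: "finite P" "card P \<le> card I"
    and f: "f \<in> functional.span P"
  shows "f = (\<Sum>i\<in>I. f (h i) *\<^sub>f w i)"
proof -
  note inj = dual_family_inj[of I w h, OF I(2)]
  have "f \<in> functional.span (w ` I)"
  proof (rule ccontr)
    assume f': "f \<notin> functional.span (w ` I)"
    then have "functional.independent (insert f (w ` I))"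
      using dual_family_independent[where w = w and h = h, OF I] by (simp add: functional.independent_insert)
    then have "card (insert f (w ` I)) \<le> card P"
      using functional.independent_span_bound[OF P(1)] w f by blast
    moreover have "card (insert f (w ` I)) = Suc (card I)"
      using I(1) f' functional.span_base[of f "w ` I"] by (subst card_insert_disjoint) (auto simp: card_image[OF inj])
    ultimately show False
      using P(2) by simp
  qed
  then obtain c where "f = (\<Sum>v\<in>w ` I. c v *\<^sub>f v)"
    using I(1) by (auto simp: functional.span_finite)
  then have f_eq: "f = (\<Sum>i\<in>I. c (w i) *\<^sub>f w i)"
    by (simp add: sum.reindex[OF inj])
  then have "f (h j) = c (w j)" if "j \<in> I" for j
    using dual_family_coefficient[of I j w h "\<lambda>i. c (w i)"] I that by simp
  then show ?thesis
    using f_eq by simp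
qed

section \<open>The dual of a subspace and its dimension\<close>

context complex_lie_algebra
begin

lemma dual_sum_scale:
  assumes "subspace H" "f \<in> dual H" "\<And>i. i \<in> I \<Longrightarrow> v i \<in> H"
  shows "f (\<Sum>i\<in>I. c i *s v i) = (\<Sum>i\<in>I. c i * f (v i))"
proof -
  \<comment> \<open>Homogeneity with scalar 0 supplies the value for the empty sum.\<close>
  have "f (0 *s 0) = 0 * f 0"
    using assms(1,2) subspace_0 unfolding dual_def by blast
  then have zero: "f 0 = 0"
    by simp
  show ?thesis
    using assms(3)
  proof (induction I rule: infinite_finite_induct)
    case (insert i I)
    then have "c i *s v i \<in> H" "(\<Sum>i\<in>I. c i *s v i) \<in> H" "v i \<in> H"
      using assms(1) by (auto intro: subspace_scale subspace_sum)
    then show ?case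
      using insert assms(2) by (simp add: dual_def)
  qed (simp_all add: zero)
qed

text \<open>The coordinate functionals of a basis of \<open>H\<close> form a basis of
  \<open>dual H\<close>.\<close>

lemma dim_dual:
  assumes "subspace H"
  shows "functional.dim (dual H) = dim H"
proof -
  obtain B where B: "B \<subseteq> H" "independent B" "H \<subseteq> span B" "card B = dim H"
    using basis_exists by blast
  have "finite B"
    using finite_dim independent_span_bound B(2) by (metis subset_UNIV)
  have span_B: "span B = H"
    using B assms by (metis span_minimal subset_antisym)
  \<comment> \<open>Members of \<open>dual H\<close> must vanish off \<open>H\<close>, hence the
    default 0.\<close>
  define w where "w b x = (if x \<in> H then representation B x b else 0)" for b x
  have w: "w b b' = (if b = b' then 1 else 0)" if "b \<in> B" "b' \<in> B" for b b'
    using B that by (auto simp: w_def representation_basis)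
  show ?thesis
  proof (rule functional.dim_unique)
    show "w ` B \<subseteq> dual H"
      using B(2) assms
      by (auto simp: dual_def w_def subspace_add subspace_scale representation_add
          representation_scale span_B)
    show "functional.independent (w ` B)"
      using dual_family_independent[of B w "\<lambda>b. b"] w \<open>finite B\<close> by blast
    show "card (w ` B) = dim H"
      using dual_family_inj[of B w "\<lambda>b. b"] w B(4) by (simp add: card_image)
    show "dual H \<subseteq> functional.span (w ` B)"
    proof
      fix f assume f: "f \<in> dual H"
      have "f = (\<Sum>b\<in>B. f b *\<^sub>f w b)"
      proof
        fix x
        show "f x = (\<Sum>b\<in>B. f b *\<^sub>f w b) x"
        proof (cases "x \<in> H")
          case True
          then have "x = (\<Sum>b\<in>B. representation B x b *s b)"
            using sum_representation_eq[OF B(2) _ \<open>finite B\<close> order_refl] span_B by simp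
          then have "f x = (\<Sum>b\<in>B. representation B x b * f b)"
            using dual_sum_scale[OF assms f, of B "\<lambda>b. b"] B(1) by (metis subsetD)
          then show ?thesis
            using True by (simp add: sum_fscale_apply w_def mult.commute)
        next
          case False
          then show ?thesis
            using f by (simp add: dual_def sum_fscale_apply w_def)
        qed
      qed
      then show "f \<in> functional.span (w ` B)"
        by (metis (no_types, lifting) functional.span_base functional.span_scale
            functional.span_sum imageI)
    qed
  qed
qed


section \<open>The monoid of dominant weights\<close>

text \<open>The simple roots are a basis of \<open>dual H\<close>, whose dimension is that of
  \<open>H\<close>.\<close>

lemma cartan_rank_eq_dim:
  assumes "subspace H" "simple_roots H \<Pi>" "has_type H \<Pi> X"
  shows "cartan_rank X = dim H"
proof -
  obtain \<alpha> where "bij_betw \<alpha> {1..cartan_rank X} \<Pi>"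
    using assms(3) by (auto simp: has_type_def)
  then have "cartan_rank X = card \<Pi>"
    using bij_betw_same_card by fastforce
  moreover have "functional.dim (dual H) = card \<Pi>"
    using assms(2) functional.dim_span_eq_card_independent[of \<Pi>] by (simp add: simple_roots_def)
  ultimately show ?thesis
    using dim_dual[OF assms(1)] by simp
qed

text \<open>Half of row \<open>j\<close> of \<open>D\<close> gives a functional with the defining
  values on the simple coroots. It is the only one, because these values determine an element of
  \<open>dual H\<close>.\<close>

lemma fundamental_weights_half_integral:
  assumes \<Pi>: "simple_roots H \<Pi>"
    and \<alpha>: "bij_betw \<alpha> {1..cartan_rank X} \<Pi>"
      "\<And>i j. i \<in> {1..cartan_rank X} \<Longrightarrow> j \<in> {1..cartan_rank X} \<Longrightarrow>
         \<alpha> i (coroot H (\<alpha> j)) = of_int (cartan_matrix X i j)"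
    and D: "half_integral_inverse X D"
    and j: "j \<in> {1..cartan_rank X}"
  shows "fundamental_weight H \<Pi> (\<alpha> j) = (\<Sum>i=1..cartan_rank X. (of_int (D j i) / 2) *\<^sub>f \<alpha> i)"
    and "k \<in> {1..cartan_rank X} \<Longrightarrow>
      fundamental_weight H \<Pi> (\<alpha> j) (coroot H (\<alpha> k)) = (if j = k then 1 else 0)"
proof -
  let ?I = "{1..cartan_rank X}"
  define w where "w j = (\<Sum>i\<in>?I. (of_int (D j i) / 2) *\<^sub>f \<alpha> i)" for j
  have w: "w j (coroot H (\<alpha> k)) = (if j = k then 1 else 0)" if "j \<in> ?I" "k \<in> ?I" for j k
  proof -
    have "w j (coroot H (\<alpha> k)) = (\<Sum>i\<in>?I. of_int (D j i * cartan_matrix X i k)) / 2"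
      using \<alpha>(2) that by (simp add: w_def sum_fscale_apply sum_divide_distrib)
    also have "\<dots> = of_int (\<Sum>i\<in>?I. D j i * cartan_matrix X i k) / 2"
      by simp
    also have "\<dots> = (if j = k then 1 else 0)"
      using D that by (simp add: half_integral_inverse_def del: of_int_sum)
    finally show ?thesis .
  qed
  have span: "functional.span \<Pi> = dual H"
    using \<Pi> by (simp add: simple_roots_def)
  have \<alpha>_in: "\<alpha> i \<in> \<Pi>" if "i \<in> ?I" for i
    using \<alpha>(1) that by (rule bij_betw_apply)
  have w_in: "w i \<in> functional.span \<Pi>" for i
    unfolding w_def
    by (intro functional.span_sum functional.span_scale functional.span_base \<alpha>_in)
  \<comment> \<open>The \<open>w i\<close> are dual to the simple coroots and as numerous as the
    simple roots, so they span; uniqueness of the fundamental weights rests on this.\<close>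
  have expansion: "f = (\<Sum>i\<in>?I. f (coroot H (\<alpha> i)) *\<^sub>f w i)" if "f \<in> functional.span \<Pi>" for f
  proof (rule dual_family_expansion[where h = "\<lambda>i. coroot H (\<alpha> i)" and P = \<Pi>])
    show "w ` ?I \<subseteq> functional.span \<Pi>"
      using w_in by blast
    show "finite \<Pi>" "card \<Pi> \<le> card ?I"
      using \<alpha>(1) by (auto dest: bij_betw_finite bij_betw_same_card)
  qed (use w that in auto)
  have weight: "fundamental_weight H \<Pi> (\<alpha> j) = w j"
    unfolding fundamental_weight_def
  proof (rule the_equality)
    have "w j (coroot H \<beta>) = (if \<beta> = \<alpha> j then 1 else 0)" if \<beta>: "\<beta> \<in> \<Pi>" for \<beta>
    proof -
      obtain k where "k \<in> ?I" "\<beta> = \<alpha> k"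
        using \<alpha>(1) \<beta> unfolding bij_betw_def by blast
      then show ?thesis
        using w j \<alpha>(1) by (auto simp: bij_betw_def inj_on_eq_iff)
    qed
    then show "w j \<in> dual H \<and> (\<forall>\<beta>\<in>\<Pi>. w j (coroot H \<beta>) = (if \<beta> = \<alpha> j then 1 else 0))"
      using w_in[of j] unfolding span by blast
  next
    fix \<omega> assume \<omega>: "\<omega> \<in> dual H \<and> (\<forall>\<beta>\<in>\<Pi>. \<omega> (coroot H \<beta>) = (if \<beta> = \<alpha> j then 1 else 0))"
    then have "\<omega> = (\<Sum>i\<in>?I. \<omega> (coroot H (\<alpha> i)) *\<^sub>f w i)"
      using expansion span by simp
    \<comment> \<open>Both functionals take the same values on the simple coroots, hence have the
      same expansion.\<close>
    also have "\<dots> = (\<Sum>i\<in>?I. w j (coroot H (\<alpha> i)) *\<^sub>f w i)"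
    proof (rule sum.cong[OF refl])
      fix i assume "i \<in> ?I"
      then show "\<omega> (coroot H (\<alpha> i)) *\<^sub>f w i = w j (coroot H (\<alpha> i)) *\<^sub>f w i"
        using \<omega> \<alpha>_in[of i] w j \<alpha>(1) by (auto simp: bij_betw_def inj_on_eq_iff)
    qed
    also have "\<dots> = w j"
      by (rule expansion[symmetric, OF w_in])
    finally show "\<omega> = w j" .
  qed
  then show "fundamental_weight H \<Pi> (\<alpha> j) = (\<Sum>i=1..cartan_rank X. (of_int (D j i) / 2) *\<^sub>f \<alpha> i)"
    by (simp add: w_def)
  show "fundamental_weight H \<Pi> (\<alpha> j) (coroot H (\<alpha> k)) = (if j = k then 1 else 0)" if "k \<in> ?I"
    using weight w j that by simp
qed

text \<open>Twice a dominant weight is a natural combination of the rows of \<open>D\<close>, so its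
  simple-root coordinates are integers.\<close>

lemma dominant_weights_in_half_root_lattice:
  fixes r :: nat
  assumes \<Pi>: "simple_roots H \<Pi>" and \<alpha>: "bij_betw \<alpha> {1..r} \<Pi>"
    and weight: "\<And>j. j \<in> {1..r} \<Longrightarrow>
      fundamental_weight H \<Pi> (\<alpha> j) = (\<Sum>i=1..r. (of_int (D j i) / 2) *\<^sub>f \<alpha> i)"
  shows "dominant_weights H \<Pi> \<subseteq> half_root_lattice H"
proof
  fix \<mu> assume "\<mu> \<in> dominant_weights H \<Pi>"
  then obtain m :: "('g \<Rightarrow> complex) \<Rightarrow> nat"
    where "\<mu> = (\<Sum>\<beta>\<in>\<Pi>. of_nat (m \<beta>) *\<^sub>f fundamental_weight H \<Pi> \<beta>)"
    by (auto simp: dominant_weights_def)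
  also have "\<dots> = (\<Sum>j=1..r. of_nat (m (\<alpha> j)) *\<^sub>f fundamental_weight H \<Pi> (\<alpha> j))"
    by (rule sum.reindex_bij_betw[OF \<alpha>, symmetric])
  also have "\<dots> = (\<Sum>j=1..r. of_nat (m (\<alpha> j)) *\<^sub>f (\<Sum>i=1..r. (of_int (D j i) / 2) *\<^sub>f \<alpha> i))"
    using weight by simp
  finally have \<mu>: "\<mu> = \<dots>" .
  define c where "c i = (\<Sum>j=1..r. int (m (\<alpha> j)) * D j i)" for i
  define \<nu> where "\<nu> = (\<Sum>i=1..r. of_int (c i) *\<^sub>f \<alpha> i)"
  have "\<mu> = (1 / 2) *\<^sub>f \<nu>"
  proof
    fix x
    have "\<mu> x = (\<Sum>j=1..r. \<Sum>i=1..r. of_nat (m (\<alpha> j)) * of_int (D j i) * \<alpha> i x / 2)"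
      unfolding \<mu> sum_fscale_apply by (simp add: sum_distrib_left mult_ac)
    also have "\<dots> = (\<Sum>i=1..r. \<Sum>j=1..r. of_nat (m (\<alpha> j)) * of_int (D j i) * \<alpha> i x / 2)"
      by (rule sum.swap)
    also have "\<dots> = (\<Sum>i=1..r. of_int (c i) * \<alpha> i x) / 2"
      by (simp add: c_def sum_distrib_right sum_divide_distrib)
    finally show "\<mu> x = ((1 / 2) *\<^sub>f \<nu>) x"
      by (simp add: \<nu>_def sum_fscale_apply fscale_def[of "1 / 2"])
  qed
  moreover have "\<nu> \<in> root_lattice H"
  proof -
    \<comment> \<open>\<open>root_lattice\<close> indexes coefficients by roots, so \<open>c\<close>
      is carried over along the inverse of the numbering.\<close>
    have "\<nu> = (\<Sum>i=1..r. of_int (c (inv_into {1..r} \<alpha> (\<alpha> i))) *\<^sub>f \<alpha> i)"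
      unfolding \<nu>_def using bij_betw_inv_into_left[OF \<alpha>] by simp
    also have "\<dots> = (\<Sum>\<beta>\<in>\<Pi>. of_int (c (inv_into {1..r} \<alpha> \<beta>)) *\<^sub>f \<beta>)"
      by (rule sum.reindex_bij_betw[OF \<alpha>])
    finally show ?thesis
      unfolding root_lattice_def using \<Pi> bij_betw_finite[OF \<alpha>]
      by (intro CollectI exI[of _ \<Pi>] exI[of _ "\<lambda>\<beta>. c (inv_into {1..r} \<alpha> \<beta>)"])
         (auto simp: simple_roots_def)
  qed
  ultimately show "\<mu> \<in> half_root_lattice H"
    unfolding half_root_lattice_def by blast
qed

text \<open>The fundamental weights generate freely: the simple coroots read off the exponents, and
  every natural combination arises from an exponent vector.\<close>

lemma bij_betw_dominant_weights:
  assumes \<alpha>: "bij_betw \<alpha> {1..r} \<Pi>"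
    and weight: "\<And>j k. j \<in> {1..r} \<Longrightarrow> k \<in> {1..r} \<Longrightarrow>
      fundamental_weight H \<Pi> (\<alpha> j) (coroot H (\<alpha> k)) = (if j = k then 1 else 0)"
  shows "bij_betw (\<lambda>m. \<Sum>j=1..r. of_nat (Poly_Mapping.lookup m j) *\<^sub>f fundamental_weight H \<Pi> (\<alpha> j))
    {m :: nat \<Rightarrow>\<^sub>0 nat. Poly_Mapping.keys m \<subseteq> {1..r}} (dominant_weights H \<Pi>)"
    (is "bij_betw ?h ?N _")
  unfolding bij_betw_def
proof
  show "inj_on ?h ?N"
  proof (rule inj_onI)
    fix m m' assume m: "m \<in> ?N" "m' \<in> ?N" "?h m = ?h m'"
    have h: "?h l (coroot H (\<alpha> k)) = of_nat (Poly_Mapping.lookup l k)" if "k \<in> {1..r}" for l k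
      using dual_family_coefficient[of "{1..r}" k "\<lambda>j. fundamental_weight H \<Pi> (\<alpha> j)"
          "\<lambda>k. coroot H (\<alpha> k)"] weight that by simp
    show "m = m'"
    proof (rule poly_mapping_eqI)
      fix k
      show "Poly_Mapping.lookup m k = Poly_Mapping.lookup m' k"
      proof (cases "k \<in> {1..r}")
        case True
        then show ?thesis
          using h[of k m] h[of k m'] m(3) by simp
      next
        case False
        then show ?thesis
          using m(1,2) by (metis (mono_tags, lifting) in_keys_iff mem_Collect_eq subsetD)
      qed
    qed
  qed
  show "?h ` ?N = dominant_weights H \<Pi>"
  proof (intro equalityI subsetI)
    fix \<mu> assume "\<mu> \<in> ?h ` ?N"
    then obtain l where "\<mu> = ?h l"
      by blast
    also have "\<dots> = (\<Sum>j=1..r. of_nat (Poly_Mapping.lookup l (inv_into {1..r} \<alpha> (\<alpha> j)))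
        *\<^sub>f fundamental_weight H \<Pi> (\<alpha> j))"
      using bij_betw_inv_into_left[OF \<alpha>] by simp
    also have "\<dots> = (\<Sum>\<beta>\<in>\<Pi>. of_nat (Poly_Mapping.lookup l (inv_into {1..r} \<alpha> \<beta>)) *\<^sub>f fundamental_weight H \<Pi> \<beta>)"
      by (rule sum.reindex_bij_betw[OF \<alpha>])
    finally show "\<mu> \<in> dominant_weights H \<Pi>"
      unfolding dominant_weights_def
      by (intro CollectI exI[of _ "\<lambda>\<beta>. Poly_Mapping.lookup l (inv_into {1..r} \<alpha> \<beta>)"]) simp
  next
    fix \<mu> assume "\<mu> \<in> dominant_weights H \<Pi>"
    then obtain m :: "('g \<Rightarrow> complex) \<Rightarrow> nat"
      where "\<mu> = (\<Sum>\<beta>\<in>\<Pi>. of_nat (m \<beta>) *\<^sub>f fundamental_weight H \<Pi> \<beta>)"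
      by (auto simp: dominant_weights_def)
    also have "\<dots> = (\<Sum>j=1..r. of_nat (m (\<alpha> j)) *\<^sub>f fundamental_weight H \<Pi> (\<alpha> j))"
      by (rule sum.reindex_bij_betw[OF \<alpha>, symmetric])
    finally have \<mu>: "\<mu> = \<dots>" .
    \<comment> \<open>The exponent vector of \<open>\<mu>\<close>, built from single terms so that
      its support is finite.\<close>
    define l where "l = (\<Sum>j=1..r. Poly_Mapping.single j (m (\<alpha> j)))"
    have l: "Poly_Mapping.lookup l k = (if k \<in> {1..r} then m (\<alpha> k) else 0)" for k
      by (simp add: l_def lookup_sum lookup_single when_def)
    then have "l \<in> ?N"
      by (auto simp: in_keys_iff split: if_splits)
    moreover have "\<mu> = ?h l"
      unfolding \<mu> using l by simp
    ultimately show "\<mu> \<in> ?h ` ?N"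
      by blast
  qed
qed

end

theorem theorem3p15:
  fixes scale :: "complex \<Rightarrow> 'g::ab_group_add \<Rightarrow> 'g"
    and bracket :: "'g \<Rightarrow> 'g \<Rightarrow> 'g"
    and H :: "'g set"
    and \<Pi> :: "('g \<Rightarrow> complex) set"
    and X :: cartan_type
    and n :: nat
  assumes "simple_complex_lie_algebra scale bracket"
    and "complex_lie_algebra.cartan_subalgebra scale bracket H"
    and "complex_lie_algebra.simple_roots scale bracket H \<Pi>"
    and "n = vector_space.dim scale H"
    and "complex_lie_algebra.has_type scale bracket H \<Pi> X"
    and "X \<in> {Type_A 1} \<union> {Type_B m | m. m \<ge> 2} \<union> {Type_C m | m. m \<ge> 3}
           \<union> {Type_D (2 * k) | k. k \<ge> 2} \<union> {Type_E7, Type_E8, Type_F4, Type_G2}"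
  shows "algebra_isomorphic
           (monoid_algebra (complex_lie_algebra.M_plus scale bracket H \<Pi>))
           (polynomial_algebra n)"
proof -
  interpret simple_complex_lie_algebra scale bracket
    by (rule assms(1))
  have "subspace H"
    using assms(2) by (simp add: cartan_subalgebra_def lie_subalgebra_def)
  then have rank: "cartan_rank X = n"
    using cartan_rank_eq_dim assms(3-5) by simp
  obtain \<alpha> where \<alpha>: "bij_betw \<alpha> {1..n} \<Pi>"
    "\<And>i j. i \<in> {1..n} \<Longrightarrow> j \<in> {1..n} \<Longrightarrow> \<alpha> i (coroot H (\<alpha> j)) = of_int (cartan_matrix X i j)"
    using assms(5) by (auto simp: has_type_def rank)
  obtain D where D: "half_integral_inverse X D"
    using half_integral_inverse_exists[OF assms(6)] by blast
  note weights = fundamental_weights_half_integral[of H \<Pi> \<alpha> X D, unfolded rank, OF assms(3) \<alpha> D]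
  \<comment> \<open>Intersecting with Q/2 removes nothing from the dominant weights.\<close>
  have M_plus: "M_plus H \<Pi> = dominant_weights H \<Pi>"
    using dominant_weights_in_half_root_lattice[OF assms(3) \<alpha>(1) weights(1)]
    by (auto simp: M_plus_def)
  define N where "N = {m :: nat \<Rightarrow>\<^sub>0 nat. Poly_Mapping.keys m \<subseteq> {1..n}}"
  define h where "h m = (\<Sum>j=1..n. of_nat (Poly_Mapping.lookup m j) *\<^sub>f fundamental_weight H \<Pi> (\<alpha> j))"
    for m :: "nat \<Rightarrow>\<^sub>0 nat"
  have h: "bij_betw h N (M_plus H \<Pi>)"
    unfolding M_plus N_def h_def by (rule bij_betw_dominant_weights[OF \<alpha>(1) weights(2)])
  have h_add: "h (a + b) = h a + h b" for a b
    by (simp add: h_def lookup_add functional.scale_left_distrib sum.distrib)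
  have N: "0 \<in> N" "\<And>a b. a \<in> N \<Longrightarrow> b \<in> N \<Longrightarrow> a + b \<in> N"
    using Poly_Mapping.keys_add by (fastforce simp: N_def)+
  have "algebra_isomorphic (monoid_algebra (M_plus H \<Pi>)) (monoid_algebra N)"
  proof (rule algebra_isomorphic_monoid_algebra)
    \<comment> \<open>The required isomorphism starts at the weights, so the inverse of
      \<open>h\<close> is extended linearly.\<close>
    show "bij_betw (inv_into N h) (M_plus H \<Pi>) N"
      using h by (rule bij_betw_inv_into)
    have "h 0 = 0"
      by (simp add: h_def)
    then show "inv_into N h 0 = 0"
      using bij_betw_inv_into_left[OF h N(1)] by simp
  next
    fix x y assume "x \<in> M_plus H \<Pi>" "y \<in> M_plus H \<Pi>"
    then obtain a b where ab: "a \<in> N" "b \<in> N" "x = h a" "y = h b"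
      using h unfolding bij_betw_def by blast
    \<comment> \<open>Since \<open>x + y = h (a + b)\<close> with \<open>a + b\<close> in
      \<open>N\<close>, inverting returns \<open>a + b\<close>.\<close>
    then show "inv_into N h (x + y) = inv_into N h x + inv_into N h y"
      using bij_betw_inv_into_left[OF h] N(2) by (simp flip: h_add)
  qed
  then show ?thesis
    by (simp add: polynomial_algebra_eq_monoid_algebra N_def)
qed

end
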